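(* For any graph $G$ of order $n$ and any positive integer $t$, $\alpha(S(G,t))=n^{t-1}\alpha(G)$, where $\alpha$ denotes the independence number.
   Context: The independence number $\alpha(G)$ is the largest cardinality of a set of pairwise non-adjacent vertices of $G$. For a graph $G=(V,E)$ and a positive integer $t$, $V^t$ denotes the set of words $u=u_1u_2\cdots u_t$ of length $t$ over the alphabet $V$. The generalized Sierpiński graph $S(G,t)$ has vertex set $V^t$, and $\{u,v\}$ is an edge if and only if there is $i\in\{1,\dots,t\}$ such that: (i) $u_j=v_j$ for all $j<i$; (ii) $u_i\ne v_i$ and $\{u_i,v_i\}\in E$; (iii) $u_j=v_i$ and $v_j=u_i$ for all $j>i$. *)

theory Defs
  imports "Graph_Theory.Graph_Theory"
begin

text \<open>
  A finite simple undirected graph is a \<open>pair_graph\<close>: an edge \<open>{x, y}\<close> is represented by the two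
  arcs \<open>(x, y)\<close> and \<open>(y, x)\<close>.
\<close>

definition independent_set :: "'a pair_pre_digraph \<Rightarrow> 'a set \<Rightarrow> bool" where
  "independent_set G A \<longleftrightarrow>
     A \<subseteq> pverts G \<and> (\<forall>x\<in>A. \<forall>y\<in>A. x \<noteq> y \<longrightarrow> (x, y) \<notin> parcs G)"

text \<open>Meaningful only for graphs with finitely many vertices, because of \<^const>\<open>Max\<close>.\<close>

definition independence_number :: "'a pair_pre_digraph \<Rightarrow> nat" where
  "independence_number G = Max (card ` {A. independent_set G A})"

text \<open>
  Words are lists, so the letter with index \<open>i\<close> in \<open>{1..t}\<close> is \<open>u ! (i - 1)\<close>; all indices below are
  shifted by one accordingly.
\<close>

definition sierpinski_words :: "'a pair_pre_digraph \<Rightarrow> nat \<Rightarrow> 'a list set" where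
  "sierpinski_words G t = {u. length u = t \<and> set u \<subseteq> pverts G}"

definition sierpinski_adj :: "'a pair_pre_digraph \<Rightarrow> nat \<Rightarrow> 'a list \<Rightarrow> 'a list \<Rightarrow> bool" where
  "sierpinski_adj G t u v \<longleftrightarrow>
     (\<exists>i<t. (\<forall>j<i. u ! j = v ! j)
          \<and> u ! i \<noteq> v ! i \<and> (u ! i, v ! i) \<in> parcs G
          \<and> (\<forall>j. i < j \<and> j < t \<longrightarrow> u ! j = v ! i \<and> v ! j = u ! i))"

definition sierpinski_graph :: "'a pair_pre_digraph \<Rightarrow> nat \<Rightarrow> 'a list pair_pre_digraph" where
  "sierpinski_graph G t =
     \<lparr> pverts = sierpinski_words G t,
       parcs = {(u, v). u \<in> sierpinski_words G t \<and> v \<in> sierpinski_words G t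
                        \<and> sierpinski_adj G t u v} \<rparr>"

lemma finite_sierpinski_words:
  assumes "finite (pverts G)"
  shows "finite (sierpinski_words G t)"
  using finite_lists_length_eq[OF assms, of t] unfolding sierpinski_words_def
  by (simp add: conj_commute)

lemma pair_graph_sierpinski_graph:
  assumes "pair_graph G"
  shows "pair_graph (sierpinski_graph G t)"
proof -
  interpret G: pair_graph G by (rule assms)
  let ?W = "sierpinski_words G t"
  have fin: "finite ?W"
    by (rule finite_sierpinski_words) (rule G.pair_finite_verts)
  have symG: "(y, x) \<in> parcs G" if "(x, y) \<in> parcs G" for x y
    using G.pair_sym_arcs that by (auto simp: symmetric_def dest: symD)
  have adj_sym: "sierpinski_adj G t v u" if "sierpinski_adj G t u v" for u v
    using that unfolding sierpinski_adj_def by (metis symG)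
  have adj_irrefl: "\<not> sierpinski_adj G t u u" for u
    by (auto simp: sierpinski_adj_def)
  show ?thesis
  proof unfold_locales
    show "finite (parcs (sierpinski_graph G t))"
      by (rule finite_subset[of _ "?W \<times> ?W"]) (auto simp: sierpinski_graph_def fin)
    show "symmetric (with_proj (sierpinski_graph G t))"
      by (auto simp: symmetric_def sierpinski_graph_def intro!: symI adj_sym)
  qed (use fin adj_irrefl in \<open>auto simp: sierpinski_graph_def\<close>)
qed

lemma independence_number_attained:
  assumes "pair_graph G"
  shows "\<exists>A. independent_set G A \<and> card A = independence_number G"
    and "independent_set G A \<Longrightarrow> card A \<le> independence_number G"
proof -
  interpret G: pair_graph G by (rule assms)
  have "finite {A. independent_set G A}"
    by (rule finite_subset[of _ "Pow (pverts G)"])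
      (auto simp: independent_set_def G.pair_finite_verts)
  then have fin: "finite (card ` {A. independent_set G A})" by simp
  moreover have "independent_set G {}" by (simp add: independent_set_def)
  then have "card ` {A. independent_set G A} \<noteq> {}" by blast
  ultimately have "independence_number G \<in> card ` {A. independent_set G A}"
    unfolding independence_number_def by (rule Max_in)
  then show "\<exists>A. independent_set G A \<and> card A = independence_number G" by auto
  show "independent_set G A \<Longrightarrow> card A \<le> independence_number G"
    unfolding independence_number_def using fin by (intro Max_ge) auto
qed

end

(* Fixing the first t - 1 letters splits S(G,t) into n^(t-1) copies of G, and an independent set
   meets each copy in at most alpha(G) words. Conversely, the last letters of two adjacent words
   are adjacent in G, so the words ending in a maximum independent set of G are independent. *)
theory Submission
  imports Defs
begin

lemma card_sierpinski_words:
  assumes "finite (pverts G)"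
  shows "card (sierpinski_words G t) = card (pverts G) ^ t"
  using card_lists_length_eq[OF assms, of t] unfolding sierpinski_words_def
  by (simp add: conj_commute)

lemma append1_in_sierpinski_words_iff:
  "w @ [x] \<in> sierpinski_words G (Suc m) \<longleftrightarrow> w \<in> sierpinski_words G m \<and> x \<in> pverts G"
  by (auto simp: sierpinski_words_def)

lemma sierpinski_words_SucE:
  assumes "u \<in> sierpinski_words G (Suc m)"
  obtains w x where "u = w @ [x]" "w \<in> sierpinski_words G m" "x \<in> pverts G"
  using assms append1_in_sierpinski_words_iff
  by (cases u rule: rev_cases) (auto simp: sierpinski_words_def)

text \<open>The witness for the first differing position is the last index \<open>m\<close>: the
  common prefix \<open>w\<close> gives agreement before it, and no index after it remains for the
  swapping condition.\<close>

lemma sierpinski_adj_append1: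
  assumes "length w = m" "(x, y) \<in> parcs G" "x \<noteq> y"
  shows "sierpinski_adj G (Suc m) (w @ [x]) (w @ [y])"
  unfolding sierpinski_adj_def using assms by (intro exI[of _ m]) (auto simp: nth_append)

text \<open>If the words first differ at the last position, their last letters are the adjacent
  letters found there. If they differ earlier, every later position carries the same two letters
  swapped, so symmetry of the arcs gives the claim even when \<open>w\<close> and \<open>w'\<close>
  differ.\<close>

lemma sierpinski_adj_last_letters:
  assumes "pair_graph G" "sierpinski_adj G (Suc m) (w @ [x]) (w' @ [y])"
    and "length w = m" "length w' = m"
  shows "x \<noteq> y \<and> (x, y) \<in> parcs G"
proof -
  interpret G: pair_graph G by (rule assms(1))
  have sym: "(b, a) \<in> parcs G" if "(a, b) \<in> parcs G" for a b
    using G.pair_sym_arcs that by (auto simp: symmetric_def dest: symD)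
  let ?u = "w @ [x]" and ?v = "w' @ [y]"
  obtain i a b where ab: "i < Suc m" "?u ! i = a" "?v ! i = b" "a \<noteq> b" "(a, b) \<in> parcs G"
    and rest: "\<And>j. i < j \<Longrightarrow> j < Suc m \<Longrightarrow> ?u ! j = b \<and> ?v ! j = a"
    using assms(2) unfolding sierpinski_adj_def by blast
  have last: "?u ! m = x" "?v ! m = y"
    using assms(3,4) by (auto simp: nth_append)
  show ?thesis
  proof (cases "i = m")
    case True
    then have "x = a" "y = b" using ab(2,3) last by simp_all
    then show ?thesis using ab(4,5) by simp
  next
    case False
    then have "x = b" "y = a" using rest[of m] ab(1) last by simp_all
    then show ?thesis using ab(4) sym[OF ab(5)] by simp
  qed
qed

lemma independence_number_sierpinski_graph_ge:
  assumes "pair_graph G"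
  shows "card (pverts G) ^ m * independence_number G
    \<le> independence_number (sierpinski_graph G (Suc m))"
proof -
  interpret G: pair_graph G by (rule assms)
  obtain A where A: "independent_set G A" "card A = independence_number G"
    using independence_number_attained(1)[OF assms] by blast
  define B where "B = (\<lambda>(w, x). w @ [x]) ` (sierpinski_words G m \<times> A)"
  have "card B = card (sierpinski_words G m \<times> A)"
    \<comment> \<open>Appending a last letter is injective on pairs, so no word of \<open>B\<close>
      is counted twice.\<close>
    unfolding B_def by (rule card_image) (auto simp: inj_on_def)
  then have card_B: "card B = card (pverts G) ^ m * independence_number G"
    using A(2) by (simp add: card_cartesian_product card_sierpinski_words G.pair_finite_verts)
  have "independent_set (sierpinski_graph G (Suc m)) B"
    unfolding independent_set_def
  proof (intro conjI ballI impI)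
    show "B \<subseteq> pverts (sierpinski_graph G (Suc m))"
      using A(1) by (auto simp: B_def sierpinski_graph_def append1_in_sierpinski_words_iff
        independent_set_def)
  next
    fix u v assume "u \<in> B" "v \<in> B"
    then obtain w x w' y where "u = w @ [x]" "v = w' @ [y]" "x \<in> A" "y \<in> A"
      "length w = m" "length w' = m"
      by (auto simp: B_def sierpinski_words_def)
    \<comment> \<open>Distinct words of \<open>B\<close> may share their last letter. Such words are
      not adjacent either, because adjacency forces \<open>x \<noteq> y\<close>; for distinct
      letters independence of \<open>A\<close> applies.\<close>
    then show "(u, v) \<notin> parcs (sierpinski_graph G (Suc m))"
      using sierpinski_adj_last_letters[OF assms] A(1)
      by (fastforce simp: sierpinski_graph_def independent_set_def)
  qed
  from independence_number_attained(2)[OF pair_graph_sierpinski_graph[OF assms] this]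
  show ?thesis by (simp add: card_B)
qed

lemma independence_number_sierpinski_graph_le:
  assumes "pair_graph G"
  shows "independence_number (sierpinski_graph G (Suc m))
    \<le> card (pverts G) ^ m * independence_number G"
proof -
  interpret G: pair_graph G by (rule assms)
  let ?W = "sierpinski_words G m"
  obtain B where B: "independent_set (sierpinski_graph G (Suc m)) B"
    "card B = independence_number (sierpinski_graph G (Suc m))"
    using independence_number_attained(1)[OF pair_graph_sierpinski_graph[OF assms]] by blast
  have B_words: "B \<subseteq> sierpinski_words G (Suc m)"
    using B(1) by (simp add: independent_set_def sierpinski_graph_def)
  \<comment> \<open>\<open>S w\<close> is the trace of \<open>B\<close> on the copy of
    \<open>G\<close> with prefix \<open>w\<close>, read off as a set of last letters.\<close>
  define S where "S w = {x. w @ [x] \<in> B}" for w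
  have fin_W: "finite ?W"
    by (rule finite_sierpinski_words) (rule G.pair_finite_verts)
  have S_verts: "S w \<subseteq> pverts G" for w
    using B_words by (auto simp: S_def append1_in_sierpinski_words_iff dest!: subsetD)
  then have fin_S: "finite (S w)" for w
    using G.pair_finite_verts finite_subset by blast
  \<comment> \<open>An arc of \<open>G\<close> inside \<open>S w\<close> would lift, by prepending
    \<open>w\<close>, to an arc between two words of \<open>B\<close>.\<close>
  have indep: "independent_set G (S w)" if "w \<in> ?W" for w
    unfolding independent_set_def
  proof (intro conjI ballI impI S_verts notI)
    fix x y assume xy: "x \<in> S w" "y \<in> S w" "x \<noteq> y" "(x, y) \<in> parcs G"
    have "sierpinski_adj G (Suc m) (w @ [x]) (w @ [y])"
      using that xy by (intro sierpinski_adj_append1) (auto simp: sierpinski_words_def)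
    moreover have uv: "w @ [x] \<in> B" "w @ [y] \<in> B" "w @ [x] \<noteq> w @ [y]"
      using xy by (simp_all add: S_def)
    moreover have "w @ [x] \<in> sierpinski_words G (Suc m)" "w @ [y] \<in> sierpinski_words G (Suc m)"
      using uv(1,2) B_words by blast+
    ultimately have "(w @ [x], w @ [y]) \<in> parcs (sierpinski_graph G (Suc m))"
      by (simp add: sierpinski_graph_def)
    then show False
      using B(1) uv unfolding independent_set_def by blast
  qed
  \<comment> \<open>Splitting off the last letter sorts the words of \<open>B\<close> by prefix,
    which turns the bound on \<open>card B\<close> into a sum over the traces.\<close>
  have "B \<subseteq> (\<lambda>(w, x). w @ [x]) ` Sigma ?W S"
  proof
    fix u assume "u \<in> B"
    moreover from this B_words have "u \<in> sierpinski_words G (Suc m)" by blast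
    ultimately show "u \<in> (\<lambda>(w, x). w @ [x]) ` Sigma ?W S"
      by (elim sierpinski_words_SucE) (auto simp: S_def image_iff)
  qed
  then have "card B \<le> card (Sigma ?W S)"
    using fin_W fin_S by (intro surj_card_le finite_SigmaI)
  also have "\<dots> = (\<Sum>w\<in>?W. card (S w))"
    using fin_W fin_S by simp
  also have "\<dots> \<le> card ?W * independence_number G"
    using sum_bounded_above[of ?W "\<lambda>w. card (S w)" "independence_number G"]
      independence_number_attained(2)[OF assms indep] by simp
  finally show ?thesis
    by (simp add: B(2) card_sierpinski_words G.pair_finite_verts)
qed

theorem theorem10:
  fixes G :: "'a pair_pre_digraph" and n t :: nat
  assumes "pair_graph G"
    and "card (pverts G) = n"
    and "t \<ge> 1"
  shows "independence_number (sierpinski_graph G t) = n ^ (t - 1) * independence_number G"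
proof -
  \<comment> \<open>Positivity of \<open>t\<close> provides a last letter to split off; the prefix
    length \<open>m\<close> is then the exponent \<open>t - 1\<close>.\<close>
  obtain m where "t = Suc m" using assms(3) by (cases t) auto
  then show ?thesis
    using independence_number_sierpinski_graph_ge[OF assms(1), of m]
      independence_number_sierpinski_graph_le[OF assms(1), of m] assms(2) by simp
qed

end
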